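(* Let $0<\lambda<1$ and $F:\mathbb{C}^2\to\mathbb{C}^2$, $F(z,w)=(\lambda z-z^2,\ w-2zw-w^2)$, and let $\Omega$ be the attracting basin of $F$ at $(0,0)$. Then for every sufficiently small $\epsilon>0$ the following holds. Let $S=\bigcup_{k\ge 0}F^{-k}(\{(\epsilon,\epsilon)\})$ be the set of preimages of $(\epsilon,\epsilon)$ under $F$. For any connected component $\tilde\Omega$ of $\Omega$, set $\tilde S:=S\cap\tilde\Omega$. Then for every constant $C>0$ there exists a point $\tilde p\in\tilde\Omega$ such that for every $q\in\tilde S$ the Kobayashi distance satisfies $d_{\tilde\Omega}(\tilde p,q)\ge C$.
   Context: The attracting basin $\Omega$ of $F$ at $(0,0)$ is the set of points of $\mathbb{C}^2$ having an open neighborhood on which the iterates $F^n$ converge uniformly to the constant $(0,0)$; it is an open set. $d_{\tilde\Omega}$ denotes the Kobayashi (pseudo)distance of the domain $\tilde\Omega$. *)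

theory Defs
  imports "HOL-Complex_Analysis.Complex_Analysis"
begin

text \<open>The space $\mathbb{C}^2$ is the product type \<^typ>\<open>complex \<times> complex\<close>.\<close>

definition attracting_basin :: "('a::metric_space \<Rightarrow> 'a) \<Rightarrow> 'a \<Rightarrow> 'a set" where
  "attracting_basin F p =
     {x. \<exists>U. open U \<and> x \<in> U \<and> uniform_limit U (\<lambda>n. F ^^ n) (\<lambda>_. p) sequentially}"

definition backward_orbit :: "('a \<Rightarrow> 'a) \<Rightarrow> 'a \<Rightarrow> 'a set" where
  "backward_orbit F p = (\<Union>k. (F ^^ k) -` {p})"

definition holomorphic_discs :: "(complex \<times> complex) set \<Rightarrow> (complex \<Rightarrow> complex \<times> complex) set" where
  "holomorphic_discs U =
     {f. (\<lambda>z. fst (f z)) holomorphic_on ball 0 1 \<and>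
         (\<lambda>z. snd (f z)) holomorphic_on ball 0 1 \<and> f ` ball 0 1 \<subseteq> U}"

text \<open>The Poincare distance of the unit disc, normalised as the integrated form of
  $|dz| / (1 - |z|^2)$ (curvature $-4$).\<close>

definition poincare_dist :: "complex \<Rightarrow> complex \<Rightarrow> real" where
  "poincare_dist a b = artanh (cmod ((a - b) / (1 - cnj a * b)))"

text \<open>The Kobayashi pseudodistance as the infimum of the lengths of chains of holomorphic
  discs. It takes values in \<^typ>\<open>ereal\<close> only so that points not joined by any
  chain are at distance \<open>\<infinity>\<close>; on a connected open set chains always exist and the
  value is finite.\<close>

definition kobayashi_dist ::
  "(complex \<times> complex) set \<Rightarrow> complex \<times> complex \<Rightarrow> complex \<times> complex \<Rightarrow> ereal" where
  "kobayashi_dist U p q =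
     Inf {ereal (\<Sum>i<n. poincare_dist (a i) (b i)) | n x f a b.
            n \<ge> 1 \<and> x 0 = p \<and> x n = q \<and>
            (\<forall>i<n. f i \<in> holomorphic_discs U \<and> a i \<in> ball 0 1 \<and> b i \<in> ball 0 1 \<and>
                   f i (a i) = x i \<and> f i (b i) = x (Suc i))}"

definition skew_map :: "real \<Rightarrow> complex \<times> complex \<Rightarrow> complex \<times> complex" where
  "skew_map l = (\<lambda>(z, w). (of_real l * z - z\<^sup>2, w - 2 * z * w - w\<^sup>2))"

end

theory Submission
  imports Defs
begin

text \<open>
  Write \<open>F\<close> for the skew product and \<open>B\<close> for its basin at the origin. Holomorphic maps do not
  increase Kobayashi distances, so \<open>F\<^sup>k q = (\<epsilon>, \<epsilon>)\<close> implies that the distance of \<open>p\<close> and \<open>q\<close> is at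
  least that of \<open>F\<^sup>k p\<close> and \<open>(\<epsilon>, \<epsilon>)\<close>. It is therefore enough to find \<open>p\<close> in the given component
  such that all the iterates \<open>F\<^sup>k p\<close> in question are far from \<open>(\<epsilon>, \<epsilon>)\<close>.

  Points of \<open>B\<close> close to the line \<open>w = 0\<close> are far away. This line is disjoint from \<open>B\<close>
  (\<open>skew_basin_avoids_axis\<close>): in the direction transversal to it the derivatives of the iterates
  are products of factors \<open>1 - 2 z\<^sub>j\<close> with \<open>z\<^sub>j\<close> tending to 0 geometrically, so they stay away from 0,
  whereas locally uniform convergence would force them to 0. Moreover \<open>\<bar>w\<bar> < 6\<close> on \<open>B\<close>. Hence
  the second coordinate maps \<open>B\<close> into a punctured disc, where the puncture is infinitely far
  away. The corresponding lower bound for the Kobayashi distance,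
  \<open>kobayashi_dist_ge_punctured_disc\<close>, comes from Harnack's inequality on the universal cover; it
  is applied directly to the second coordinate of \<open>F\<^sup>k\<close>, which includes the passage from \<open>p\<close>
  to \<open>F\<^sup>k p\<close>.

  The forward orbit of \<open>(\<epsilon>, \<epsilon>)\<close> provides points close to that line which remain close to it.
  For small \<open>\<epsilon>\<close> this orbit lies in a convex set of real points of \<open>B\<close>
  (\<open>real_rectangle_subset_skew_basin\<close>), hence in a single component \<open>D\<close> of \<open>B\<close>. If the given
  component contains preimages of \<open>(\<epsilon>, \<epsilon>)\<close> at all, and \<open>k\<^sub>0\<close> is the least number of steps in which
  one of them reaches \<open>(\<epsilon>, \<epsilon>)\<close>, then \<open>F\<close> to the power \<open>k\<^sub>0\<close> maps the component onto \<open>D\<close>, because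
  \<open>F\<close> is open and \<open>B\<close> is bounded and completely invariant (\<open>component_subset_image\<close>). Take for \<open>p\<close>
  a point that is mapped to \<open>F\<^sup>N (\<epsilon>, \<epsilon>)\<close> with \<open>N\<close> large. For every \<open>k \<ge> k\<^sub>0\<close> the iterate \<open>F\<^sup>k p\<close> is then
  a late point of the orbit of \<open>(\<epsilon>, \<epsilon>)\<close>.
\<close>

section \<open>Lower bounds for the Kobayashi distance\<close>

text \<open>
  Precomposing with an automorphism of the disc that moves 0 to \<open>b\<close>, and postcomposing with the
  Cayley transform of the half plane that moves \<open>h b\<close> to 0, turns \<open>h\<close> into a map \<open>\<psi>\<close> to which
  the Schwarz lemma applies. Discarding the imaginary parts in the resulting bound leaves
  Harnack's inequality \<open>Re (h a) \<le> (1 + \<rho>) / (1 - \<rho>) * Re (h b)\<close>, whose logarithm is the claim.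
\<close>

lemma Re_pos_disc_Harnack:
  assumes hol: "h holomorphic_on ball 0 1"
    and pos: "\<And>z. z \<in> ball 0 1 \<Longrightarrow> 0 < Re (h z)"
    and a: "a \<in> ball 0 1" and b: "b \<in> ball 0 1"
  shows "ln (Re (h a)) - ln (Re (h b)) \<le> 2 * poincare_dist a b"
proof -
  define m where "m = Moebius_function 0 (- b)"
  define \<zeta> where "\<zeta> = Moebius_function 0 b a"
  define \<rho> where "\<rho> = cmod ((a - b) / (1 - cnj a * b))"
  define \<psi> where "\<psi> z = (h (m z) - h b) / (h (m z) + cnj (h b))" for z
  have nb: "norm b < 1" "norm (- b) < 1" and na: "norm a < 1" using a b by auto
  have m_in: "m z \<in> ball 0 1" if "z \<in> ball 0 1" for z
    using Moebius_function_norm_lt_1[OF nb(2), of z 0] that by (simp add: m_def)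
  have m0: "m 0 = b" by (simp add: m_def Moebius_function_of_zero)
  have \<zeta>: "norm \<zeta> < 1" unfolding \<zeta>_def using Moebius_function_norm_lt_1[OF nb(1) na] .
  have m\<zeta>: "m \<zeta> = a" unfolding m_def \<zeta>_def
    by (rule Moebius_function_compose) (use na nb in auto)
  have \<rho>: "norm \<zeta> = \<rho>"
  proof -
    have "cmod (1 - cnj b * a) = cmod (cnj (1 - cnj a * b))" by (simp add: mult.commute)
    then show ?thesis unfolding \<zeta>_def \<rho>_def Moebius_function_simple norm_divide
      by (simp only: complex_mod_cnj)
  qed
  \<comment> \<open>This identity is why the Cayley transform maps the half plane into the disc; it is used
    again at the end to eliminate the imaginary parts.\<close>
  have sq: "(cmod (u - v))\<^sup>2 = (cmod (u + cnj v))\<^sup>2 - 4 * (Re u * Re v)" for u v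
    unfolding cmod_power2 by (simp add: power2_eq_square algebra_simps)
  have Rb: "0 < Re (h b)" and Ra: "0 < Re (h a)" using pos a b by auto
  have den: "h (m z) + cnj (h b) \<noteq> 0" if "z \<in> ball 0 1" for z
    using pos[OF m_in[OF that]] Rb
    by (auto simp: complex_eq_iff)
  have "\<psi> holomorphic_on ball 0 1"
  proof -
    have "(h \<circ> m) holomorphic_on ball 0 1"
      by (rule holomorphic_on_compose_gen[of m "ball 0 1" h "ball 0 1"])
        (use hol m_in in \<open>auto simp: m_def intro!: Moebius_function_holomorphic nb\<close>)
    then have "(\<lambda>z. h (m z)) holomorphic_on ball 0 1" by (simp add: o_def)
    then show ?thesis unfolding \<psi>_def
      by (intro holomorphic_intros) (use den in auto)
  qed
  moreover have "\<psi> 0 = 0" by (simp add: \<psi>_def m0)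
  moreover have "norm (\<psi> z) < 1" if "norm z < 1" for z
  proof -
    have zb: "z \<in> ball 0 1" using that by simp
    have "(cmod (h (m z) - h b))\<^sup>2 < (cmod (h (m z) + cnj (h b)))\<^sup>2"
      using sq[of "h (m z)" "h b"] mult_pos_pos[OF pos[OF m_in[OF zb]] Rb] by linarith
    then have "cmod (h (m z) - h b) < cmod (h (m z) + cnj (h b))"
      by (rule power2_less_imp_less) simp
    then show ?thesis unfolding \<psi>_def norm_divide using den[OF zb] by (simp add: divide_less_eq)
  qed
  ultimately have "norm (\<psi> \<zeta>) \<le> norm \<zeta>" using Schwarz_Lemma(1) \<zeta> by blast
  moreover have "h a + cnj (h b) \<noteq> 0" using den[of \<zeta>] \<zeta> m\<zeta> by simp
  ultimately have le: "cmod (h a - h b) \<le> \<rho> * cmod (h a + cnj (h b))"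
    unfolding \<psi>_def m\<zeta> \<rho> norm_divide by (simp add: divide_le_eq)
  define x y s where "x = Re (h a)" and "y = Re (h b)" and "s = cmod (h a + cnj (h b))"
  have xy: "0 < x" "0 < y" using Ra Rb by (auto simp: x_def y_def)
  have \<rho>01: "0 \<le> \<rho>" "\<rho> < 1" using \<zeta> \<rho> by (auto simp: \<rho>_def)
  have s: "x + y \<le> s" unfolding x_def y_def s_def
    using complex_Re_le_cmod[of "h a + cnj (h b)"] by simp
  have "s\<^sup>2 - 4 * (x * y) \<le> (\<rho> * s)\<^sup>2"
    unfolding x_def y_def s_def sq[symmetric] by (rule power_mono[OF le]) simp
  then have "(1 - \<rho>\<^sup>2) * s\<^sup>2 \<le> 4 * (x * y)" by (simp add: power_mult_distrib algebra_simps)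
  moreover have "(1 - \<rho>\<^sup>2) * (x + y)\<^sup>2 \<le> (1 - \<rho>\<^sup>2) * s\<^sup>2"
    by (rule mult_left_mono[OF power_mono[OF s]]) (use xy \<rho>01 in \<open>auto simp: power_le_one\<close>)
  ultimately have "(1 - \<rho>\<^sup>2) * (x + y)\<^sup>2 \<le> 4 * (x * y)" by linarith
  then have "(x - y)\<^sup>2 \<le> (\<rho> * (x + y))\<^sup>2" by (simp add: power2_eq_square algebra_simps)
  then have "x - y \<le> \<rho> * (x + y)"
    by (rule power2_le_imp_le) (use xy \<rho>01 in auto)
  then have "x \<le> (1 + \<rho>) / (1 - \<rho>) * y" using \<rho>01 by (simp add: field_simps)
  then have "ln x \<le> ln ((1 + \<rho>) / (1 - \<rho>) * y)" using xy by simp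
  also have "\<dots> = ln ((1 + \<rho>) / (1 - \<rho>)) + ln y"
    by (rule ln_mult_pos) (use xy \<rho>01 in auto)
  finally show ?thesis
    unfolding poincare_dist_def \<rho>_def[symmetric] artanh_def x_def y_def by simp
qed

text \<open>
  The right half plane is the universal cover of the punctured disc of radius \<open>R\<close> via
  \<open>h \<mapsto> R exp (- h)\<close>. On lifting \<open>g\<close> to the cover, \<open>ln (R / \<bar>g\<bar>)\<close> becomes a positive real part,
  to which Harnack's inequality applies.
\<close>

lemma punctured_disc_Harnack:
  assumes hol: "g holomorphic_on ball 0 1"
    and bd: "\<And>z. z \<in> ball 0 1 \<Longrightarrow> g z \<noteq> 0 \<and> cmod (g z) < R"
    and a: "a \<in> ball 0 1" and b: "b \<in> ball 0 1"
  shows "ln (ln (R / cmod (g a))) - ln (ln (R / cmod (g b))) \<le> 2 * poincare_dist a b"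
proof -
  have R: "0 < R" using bd[OF a] by (meson norm_ge_zero le_less_trans)
  have "(\<lambda>z. R / g z) holomorphic_on ball 0 1"
    using bd by (intro holomorphic_intros hol) auto
  then obtain h where h: "h holomorphic_on ball 0 1"
      and eq: "\<And>z. z \<in> ball 0 1 \<Longrightarrow> R / g z = exp (h z)"
    using contractible_imp_holomorphic_log[of "\<lambda>z. R / g z" "ball 0 1"] bd R
    by (auto simp: convex_imp_contractible)
  have Re: "ln (R / cmod (g z)) = Re (h z)" if "z \<in> ball 0 1" for z
    using arg_cong[OF eq[OF that], of cmod] R by (simp add: norm_divide)
  have "0 < Re (h z)" if "z \<in> ball 0 1" for z
    unfolding Re[OF that, symmetric] using bd[OF that] by (intro ln_gt_zero) (simp add: less_divide_eq)
  from Re_pos_disc_Harnack[OF h this a b] show ?thesis unfolding Re[OF a] Re[OF b] .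
qed

text \<open>Along a chain of discs the increments of \<open>V\<close> telescope.\<close>

lemma kobayashi_dist_ge:
  assumes V: "\<And>f a b. f \<in> holomorphic_discs U \<Longrightarrow> a \<in> ball 0 1 \<Longrightarrow> b \<in> ball 0 1 \<Longrightarrow>
    V (f a) - V (f b) \<le> poincare_dist a b"
  shows "ereal (V p - V q) \<le> kobayashi_dist U p q"
  unfolding kobayashi_dist_def
proof (rule Inf_greatest, clarify)
  fix n :: nat and x :: "nat \<Rightarrow> complex \<times> complex" and f a b
  assume pq: "p = x 0" "q = x n" and
    ch: "\<forall>i<n. f i \<in> holomorphic_discs U \<and> a i \<in> ball 0 1 \<and> b i \<in> ball 0 1 \<and>
      f i (a i) = x i \<and> f i (b i) = x (Suc i)"
  have "V (x 0) - V (x n) = (\<Sum>i<n. V (x i) - V (x (Suc i)))"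
    by (induction n) auto
  also have "\<dots> \<le> (\<Sum>i<n. poincare_dist (a i) (b i))"
    by (rule sum_mono) (metis V ch lessThan_iff)
  finally show "ereal (V (x 0) - V (x n)) \<le> ereal (\<Sum>i<n. poincare_dist (a i) (b i))"
    by simp
qed

text \<open>
  This tends to \<open>\<infinity>\<close> as \<open>g p\<close> approaches the puncture 0 while \<open>q\<close> stays fixed: the puncture is
  infinitely far away in the hyperbolic metric of the punctured disc.
\<close>

lemma kobayashi_dist_ge_punctured_disc:
  assumes hol: "\<And>f. f \<in> holomorphic_discs U \<Longrightarrow> (\<lambda>z. g (f z)) holomorphic_on ball 0 1"
    and bd: "\<And>x. x \<in> U \<Longrightarrow> g x \<noteq> 0 \<and> cmod (g x) < R"
  shows "ereal ((ln (ln (R / cmod (g p))) - ln (ln (R / cmod (g q)))) / 2) \<le> kobayashi_dist U p q"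
proof -
  define V where "V x = ln (ln (R / cmod (g x))) / 2" for x
  have "V (f a) - V (f b) \<le> poincare_dist a b"
    if f: "f \<in> holomorphic_discs U" and ab: "a \<in> ball 0 1" "b \<in> ball 0 1" for f a b
  proof -
    have "g (f z) \<noteq> 0 \<and> cmod (g (f z)) < R" if "z \<in> ball 0 1" for z
      by (rule bd) (use f that in \<open>auto simp: holomorphic_discs_def\<close>)
    from punctured_disc_Harnack[OF hol[OF f] this ab] show ?thesis by (simp add: V_def)
  qed
  from kobayashi_dist_ge[of U V, OF this] show ?thesis
    by (simp add: V_def diff_divide_distrib)
qed

section \<open>Attracting basins and open maps\<close>

lemma open_attracting_basin: "open (attracting_basin F p)"
  by (subst open_subopen) (auto simp: attracting_basin_def)

lemma attracting_basin_tendsto: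
  assumes "x \<in> attracting_basin F p"
  shows "(\<lambda>n. (F ^^ n) x) \<longlonglongrightarrow> p"
  using assms tendsto_uniform_limitI by (fastforce simp: attracting_basin_def)

lemma continuous_on_funpow:
  fixes F :: "'a::topological_space \<Rightarrow> 'a"
  assumes "continuous_on UNIV F"
  shows "continuous_on UNIV (F ^^ k)"
proof (induction k)
  case (Suc k)
  then have "continuous_on UNIV (F \<circ> (F ^^ k))"
    by (rule continuous_on_compose) (rule continuous_on_subset[OF assms subset_UNIV])
  then show ?case by simp
qed (simp add: id_def)

lemma open_image_funpow:
  fixes F :: "'a::topological_space \<Rightarrow> 'a"
  assumes "\<And>U. open U \<Longrightarrow> open (F ` U)" and "open U"
  shows "open ((F ^^ k) ` U)"
proof (induction k)
  case (Suc k)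
  then show ?case using assms(1)[OF Suc] by (simp add: image_comp)
qed (use assms(2) in simp)

lemma attracting_basin_backward:
  assumes cont: "continuous_on UNIV F" and x: "(F ^^ k) x \<in> attracting_basin F p"
  shows "x \<in> attracting_basin F p"
proof -
  obtain U where U: "open U" "(F ^^ k) x \<in> U"
      "uniform_limit U (\<lambda>n. F ^^ n) (\<lambda>_. p) sequentially"
    using x by (auto simp: attracting_basin_def)
  define W where "W = (F ^^ k) -` U"
  have "open W"
    unfolding W_def using continuous_on_funpow[OF cont, of k] U(1)
    by (simp add: continuous_on_open_vimage)
  moreover have "uniform_limit W (\<lambda>n. F ^^ n) (\<lambda>_. p) sequentially"
    unfolding uniform_limit_sequentially_iff
  proof (intro allI impI)
    fix e :: real assume "0 < e"
    then obtain N where N: "\<And>n x. n \<ge> N \<Longrightarrow> x \<in> U \<Longrightarrow> dist ((F ^^ n) x) p < e"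
      using U(3) unfolding uniform_limit_sequentially_iff by meson
    have "dist ((F ^^ n) x) p < e" if n: "n \<ge> N + k" and x: "x \<in> W" for n x
    proof -
      have "(F ^^ n) x = (F ^^ (n - k)) ((F ^^ k) x)"
        using n by (simp add: funpow_add[symmetric] flip: o_apply[of "F ^^ (n - k)"])
      then show ?thesis using N[of "n - k" "(F ^^ k) x"] n x by (simp add: W_def)
    qed
    then show "\<exists>N. \<forall>n\<ge>N. \<forall>x\<in>W. dist ((F ^^ n) x) p < e" by blast
  qed
  ultimately show ?thesis using U(2) by (auto simp: attracting_basin_def W_def)
qed

lemma attracting_basin_forward:
  assumes op: "\<And>U. open U \<Longrightarrow> open (F ` U)" and x: "x \<in> attracting_basin F p"
  shows "(F ^^ k) x \<in> attracting_basin F p"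
proof -
  obtain U where U: "open U" "x \<in> U"
      "uniform_limit U (\<lambda>n. F ^^ n) (\<lambda>_. p) sequentially"
    using x by (auto simp: attracting_basin_def)
  have "uniform_limit ((F ^^ k) ` U) (\<lambda>n. F ^^ n) (\<lambda>_. p) sequentially"
    unfolding uniform_limit_sequentially_iff
  proof (intro allI impI)
    fix e :: real assume "0 < e"
    then obtain N where N: "\<And>n x. n \<ge> N \<Longrightarrow> x \<in> U \<Longrightarrow> dist ((F ^^ n) x) p < e"
      using U(3) unfolding uniform_limit_sequentially_iff by meson
    have "dist ((F ^^ n) ((F ^^ k) x)) p < e" if "n \<ge> N" "x \<in> U" for n x
      using N[of "n + k" x] that by (simp add: funpow_add)
    then show "\<exists>N. \<forall>n\<ge>N. \<forall>x\<in>(F ^^ k) ` U. dist ((F ^^ n) x) p < e" by blast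
  qed
  with open_image_funpow[OF op U(1)] U(2) show ?thesis
    by (auto simp: attracting_basin_def)
qed

text \<open>
  Bounded sets are relatively compact, so a limit in \<open>B\<close> of image points \<open>G (v n)\<close> with \<open>v n\<close>
  in \<open>C\<close> is the image of a cluster point \<open>c\<close> of the sequence \<open>v\<close>. Invariance puts \<open>c\<close> back
  into \<open>B\<close>, and then into \<open>C\<close> because components of open sets are open. Hence the image of
  \<open>C\<close> is clopen in the component \<open>D\<close> that it meets.
\<close>

lemma component_subset_image:
  fixes G :: "'a::euclidean_space \<Rightarrow> 'a"
  assumes cont: "continuous_on UNIV G" and op: "\<And>U. open U \<Longrightarrow> open (G ` U)"
    and B: "open B" "bounded B" and inv: "\<And>x. G x \<in> B \<Longrightarrow> x \<in> B"
    and C: "C \<in> components B" and D: "D \<in> components B"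
    and a: "a \<in> C" "G a \<in> D"
  shows "D \<subseteq> G ` C"
proof -
  have oC: "open C" using open_components[OF B(1) C] .
  define T where "T = D \<inter> G ` C"
  have "openin (top_of_set D) T"
    unfolding T_def by (rule openin_open_Int[OF op[OF oC]])
  moreover have "closedin (top_of_set D) T"
  proof -
    have "y \<in> G ` C" if yD: "y \<in> D" and y: "y \<in> closure (G ` C)" for y
    proof -
      obtain u where u: "\<And>n. u n \<in> G ` C" "u \<longlonglongrightarrow> y"
        using y by (auto simp: closure_sequential)
      then have "\<forall>n. \<exists>c. c \<in> C \<and> u n = G c" by blast
      then obtain v where v: "\<And>n. v n \<in> C" "\<And>n. u n = G (v n)" by metis
      have "range v \<subseteq> closure B" using v(1) in_components_subset[OF C] closure_subset by blast
      moreover have "compact (closure B)" using B(2) by simp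
      ultimately obtain c r where c: "strict_mono r" "(v \<circ> r) \<longlonglongrightarrow> c"
        unfolding compact_def by (meson range_subsetD)
      have "isCont G c" using cont by (simp add: continuous_on_eq_continuous_at)
      then have "(\<lambda>n. G ((v \<circ> r) n)) \<longlonglongrightarrow> G c" using c(2) by (rule isCont_tendsto_compose)
      moreover have "(\<lambda>n. G ((v \<circ> r) n)) \<longlonglongrightarrow> y"
        using LIMSEQ_subseq_LIMSEQ[OF u(2) c(1)] v(2) by (simp add: o_def)
      ultimately have Gc: "G c = y" by (rule LIMSEQ_unique)
      then have "c \<in> B" using inv yD in_components_subset[OF D] by blast
      define E where "E = connected_component_set B c"
      have E: "E \<in> components B" "c \<in> E"
        unfolding E_def using \<open>c \<in> B\<close> by (auto intro: componentsI)
      have "\<forall>\<^sub>F n in sequentially. (v \<circ> r) n \<in> E"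
        using topological_tendstoD[OF c(2) open_components[OF B(1) E(1)] E(2)] .
      then obtain n where "(v \<circ> r) n \<in> E" by (auto simp: eventually_sequentially)
      then have "E = C" using v(1) C E(1) components_eq by (metis IntI comp_apply empty_iff)
      then show ?thesis using E(2) Gc by blast
    qed
    then have "T = D \<inter> closure (G ` C)"
      unfolding T_def using closure_subset by blast
    then show ?thesis by (metis closed_closure closedin_closed_Int)
  qed
  moreover have "T \<noteq> {}" unfolding T_def using a by blast
  ultimately have "T = D" using in_components_connected[OF D] connected_clopen by blast
  then show ?thesis unfolding T_def by blast
qed

section \<open>The skew product as an open map\<close>

lemma open_image_map_prod:
  fixes f :: "'a::topological_space \<Rightarrow> 'b::topological_space"
    and g :: "'c::topological_space \<Rightarrow> 'd::topological_space"
  assumes f: "\<And>U. open U \<Longrightarrow> open (f ` U)" and g: "\<And>U. open U \<Longrightarrow> open (g ` U)"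
    and U: "open U"
  shows "open (map_prod f g ` U)"
proof (rule open_prod_intro)
  fix y assume "y \<in> map_prod f g ` U"
  then obtain x where x: "y = map_prod f g x" "x \<in> U" by (rule imageE)
  obtain A B where AB: "open A" "open B" "x \<in> A \<times> B" "A \<times> B \<subseteq> U"
    using open_prod_elim[OF U x(2)] .
  have "y \<in> f ` A \<times> g ` B" using AB(3) x(1) by (auto simp: mem_Times_iff)
  moreover have "f ` A \<times> g ` B \<subseteq> map_prod f g ` U" using AB(4) by force
  ultimately show "\<exists>A B. open A \<and> open B \<and> y \<in> A \<times> B \<and> A \<times> B \<subseteq> map_prod f g ` U"
    using f[OF AB(1)] g[OF AB(2)] by blast
qed

lemma open_image_power2:
  assumes "open (U :: complex set)"
  shows "open ((\<lambda>z. z\<^sup>2) ` U)"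
proof (rule open_mapping_thm[OF _ open_UNIV connected_UNIV assms subset_UNIV])
  show "\<not> (\<lambda>z::complex. z\<^sup>2) constant_on UNIV"
    unfolding constant_on_def by (metis UNIV_I one_power2 zero_neq_one zero_power2)
qed (intro holomorphic_intros)

lemma open_image_homeo:
  assumes "continuous_on UNIV g" and "\<And>x. g (f x) = x" and "\<And>y. f (g y) = y" and "open U"
  shows "open (f ` U)"
proof -
  have "f ` U = g -` U" using assms(2,3) by (auto simp: image_iff) metis
  then show ?thesis using assms(1,4) by (simp add: continuous_on_open_vimage)
qed

lemma fst_skew_map: "fst (skew_map l x) = fst x * (of_real l - fst x)"
  by (simp add: skew_map_def case_prod_beta power2_eq_square algebra_simps)

lemma snd_skew_map: "snd (skew_map l x) = snd x * (1 - 2 * fst x - snd x)"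
  by (simp add: skew_map_def case_prod_beta power2_eq_square algebra_simps)

lemma continuous_on_skew_map: "continuous_on UNIV (skew_map l)"
  unfolding skew_map_def case_prod_beta by (intro continuous_intros)

text \<open>
  Completing the square in the second and then in the first coordinate writes the skew product
  as a composition of homeomorphisms with squarings of a single coordinate.
\<close>

lemma open_image_skew_map:
  assumes "open U"
  shows "open (skew_map l ` U)"
proof -
  define h1 :: "complex \<times> complex \<Rightarrow> complex \<times> complex"
    where "h1 = (\<lambda>(z, w). (z, w - (1 - 2 * z) / 2))"
  define h2 :: "complex \<times> complex \<Rightarrow> complex \<times> complex"
    where "h2 = (\<lambda>(z, w). (z - of_real l / 2, (1 - 2 * z)\<^sup>2 / 4 - w))"
  define h3 :: "complex \<times> complex \<Rightarrow> complex \<times> complex"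
    where "h3 = (\<lambda>(z, w). ((of_real l)\<^sup>2 / 4 - z, w))"
  have eq: "skew_map l = h3 \<circ> map_prod (\<lambda>z. z\<^sup>2) id \<circ> h2 \<circ> map_prod id (\<lambda>z. z\<^sup>2) \<circ> h1"
    by (auto simp: fun_eq_iff skew_map_def h1_def h2_def h3_def power2_eq_square field_simps)
  have 1: "open (h1 ` U)" if "open U" for U
    by (rule open_image_homeo[of "\<lambda>(z, w). (z, w + (1 - 2 * z) / 2)"])
      (use that in \<open>auto simp: h1_def case_prod_beta intro!: continuous_intros\<close>)
  have 2: "open (h2 ` U)" if "open U" for U
    by (rule open_image_homeo[of "\<lambda>(z, w). (z + of_real l / 2, (1 - 2 * (z + of_real l / 2))\<^sup>2 / 4 - w)"])
      (use that in \<open>auto simp: h2_def case_prod_beta intro!: continuous_intros\<close>)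
  have 3: "open (h3 ` U)" if "open U" for U
    by (rule open_image_homeo[of "\<lambda>(z, w). ((of_real l)\<^sup>2 / 4 - z, w)"])
      (use that in \<open>auto simp: h3_def case_prod_beta intro!: continuous_intros\<close>)
  show ?thesis
    unfolding eq image_comp[symmetric]
    by (intro 3 2 1 open_image_map_prod open_image_power2 assms) auto
qed

section \<open>The basin is bounded and avoids the invariant line\<close>

abbreviation skew_basin :: "real \<Rightarrow> (complex \<times> complex) set" where
  "skew_basin l \<equiv> attracting_basin (skew_map l) (0, 0)"

lemma skew_basin_forward: "x \<in> skew_basin l \<Longrightarrow> (skew_map l ^^ k) x \<in> skew_basin l"
  by (rule attracting_basin_forward[OF open_image_skew_map])

lemma skew_basin_tendsto:
  assumes "x \<in> skew_basin l"
  shows "(\<lambda>n. fst ((skew_map l ^^ n) x)) \<longlonglongrightarrow> 0" and "(\<lambda>n. snd ((skew_map l ^^ n) x)) \<longlonglongrightarrow> 0"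
  using tendsto_fst[OF attracting_basin_tendsto[OF assms]]
    tendsto_snd[OF attracting_basin_tendsto[OF assms]] by simp_all

lemma not_tendsto_0_if_norm_ge:
  assumes "\<And>n. c \<le> norm (f n)" "0 < c" shows "\<not> f \<longlonglongrightarrow> (0::'a::real_normed_vector)"
proof
  assume "f \<longlonglongrightarrow> 0"
  then have "\<forall>\<^sub>F n in sequentially. norm (f n) < c"
    using assms(2) by (metis order_tendstoD(2) tendsto_norm_zero)
  then show False using assms(1) by (auto simp: eventually_sequentially not_less[symmetric])
qed

text \<open>
  Outside the bounds of the next two lemmas the modulus of the coordinate in question does not
  decrease along the orbit. For the second coordinate this uses that the first one stays
  below 2.
\<close>

lemma skew_basin_fst_bound:
  assumes l: "0 < l" "l < 1" and x: "x \<in> skew_basin l"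
  shows "cmod (fst x) < 2"
proof (rule ccontr)
  assume "\<not> cmod (fst x) < 2"
  then have "2 \<le> cmod (fst ((skew_map l ^^ n) x))" for n
  proof (induction n)
    case (Suc n)
    define z where "z = fst ((skew_map l ^^ n) x)"
    have z: "2 \<le> cmod z" using Suc by (simp add: z_def)
    have "1 \<le> cmod (of_real l - z)"
      using norm_triangle_ineq2[of z "of_real l"] z l by (simp add: norm_minus_commute)
    then have "2 * 1 \<le> cmod z * cmod (of_real l - z)" by (intro mult_mono z) auto
    then show ?case by (simp add: fst_skew_map z_def norm_mult)
  qed simp
  then have "\<not> (\<lambda>n. fst ((skew_map l ^^ n) x)) \<longlonglongrightarrow> 0"
    by (rule not_tendsto_0_if_norm_ge) simp
  then show False using skew_basin_tendsto(1)[OF x] by contradiction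
qed

lemma skew_basin_snd_bound:
  assumes l: "0 < l" "l < 1" and x: "x \<in> skew_basin l"
  shows "cmod (snd x) < 6"
proof (rule ccontr)
  assume "\<not> cmod (snd x) < 6"
  then have "6 \<le> cmod (snd ((skew_map l ^^ n) x))" for n
  proof (induction n)
    case (Suc n)
    define z w where "z = fst ((skew_map l ^^ n) x)" and "w = snd ((skew_map l ^^ n) x)"
    have w: "6 \<le> cmod w" using Suc by (simp add: w_def)
    have z: "cmod z < 2"
      unfolding z_def by (rule skew_basin_fst_bound[OF l skew_basin_forward[OF x]])
    have "cmod (1 - 2 * z) \<le> 5"
      using norm_triangle_ineq4[of 1 "2 * z"] z by (simp add: norm_mult)
    then have "1 \<le> cmod (1 - 2 * z - w)"
      using norm_triangle_ineq2[of w "1 - 2 * z"] w by (simp add: norm_minus_commute)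
    then have "6 * 1 \<le> cmod w * cmod (1 - 2 * z - w)" by (intro mult_mono w) auto
    then show ?case by (simp add: snd_skew_map z_def w_def norm_mult)
  qed simp
  then have "\<not> (\<lambda>n. snd ((skew_map l ^^ n) x)) \<longlonglongrightarrow> 0"
    by (rule not_tendsto_0_if_norm_ge) simp
  then show False using skew_basin_tendsto(2)[OF x] by contradiction
qed

lemma bounded_skew_basin:
  assumes "0 < l" "l < 1"
  shows "bounded (skew_basin l)"
proof (rule bounded_subset)
  show "bounded (ball (0::complex) 2 \<times> ball (0::complex) 6)" by (intro bounded_Times bounded_ball)
  show "skew_basin l \<subseteq> ball 0 2 \<times> ball 0 6"
    using skew_basin_fst_bound[OF assms] skew_basin_snd_bound[OF assms] by force
qed

lemma snd_skew_map_funpow_axis: "snd ((skew_map l ^^ n) (z, 0)) = 0"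
  by (induction n) (simp_all add: snd_skew_map)

lemma holomorphic_skew_map_funpow:
  assumes "(\<lambda>\<zeta>. fst (f \<zeta>)) holomorphic_on S" "(\<lambda>\<zeta>. snd (f \<zeta>)) holomorphic_on S"
  shows "(\<lambda>\<zeta>. fst ((skew_map l ^^ k) (f \<zeta>))) holomorphic_on S"
    and "(\<lambda>\<zeta>. snd ((skew_map l ^^ k) (f \<zeta>))) holomorphic_on S"
proof (induction k)
  case (Suc k)
  show "(\<lambda>\<zeta>. fst ((skew_map l ^^ Suc k) (f \<zeta>))) holomorphic_on S"
    unfolding funpow.simps o_apply fst_skew_map by (intro holomorphic_intros Suc)
  show "(\<lambda>\<zeta>. snd ((skew_map l ^^ Suc k) (f \<zeta>))) holomorphic_on S"
    unfolding funpow.simps o_apply snd_skew_map by (intro holomorphic_intros Suc)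
qed (use assms in simp_all)

text \<open>
  Along the orbit of \<open>(z, 0)\<close> the derivative in the second direction is the product of the
  factors \<open>1 - 2 P j\<close>, where \<open>P j\<close> is the first coordinate of the \<open>j\<close>-th iterate. For small \<open>z\<close>
  the sum of the \<open>\<bar>P j\<bar>\<close> is dominated by a geometric series with a small value, so the product
  stays away from 0 uniformly in \<open>n\<close>.
\<close>

lemma transversal_derivative_lower_bound:
  assumes l: "0 < l" "l < 1" and z: "cmod z \<le> (1 - l) / 8"
  shows "\<exists>d. ((\<lambda>w. snd ((skew_map l ^^ n) (z, w))) has_field_derivative d) (at 0) \<and> 1 / 2 \<le> cmod d"
proof -
  define P where "P j = fst ((skew_map l ^^ j) (z, 0))" for j
  have fst_eq: "fst ((skew_map l ^^ j) (z, w)) = P j" for j w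
    unfolding P_def by (induction j) (simp_all add: fst_skew_map)
  define r where "r = (1 - l) / 8"
  define \<mu> where "\<mu> = l + r"
  have r: "0 < r" and \<mu>: "0 < \<mu>" "\<mu> < 1" and r\<mu>: "2 * r / (1 - \<mu>) \<le> 1 / 2"
    using l by (auto simp: r_def \<mu>_def divide_simps)
  have zj: "cmod (P j) \<le> r * \<mu> ^ j" for j
  proof (induction j)
    case 0 show ?case using z by (simp add: r_def P_def)
  next
    case (Suc j)
    define u where "u = P j"
    have u: "cmod u \<le> r * \<mu> ^ j" using Suc by (simp add: u_def)
    also have "\<dots> \<le> r * 1" using r \<mu> by (intro mult_left_mono) (auto simp: power_le_one)
    finally have "cmod (of_real l - u) \<le> \<mu>"
      using norm_triangle_ineq4[of "of_real l" u] l by (simp add: \<mu>_def)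
    then have "cmod u * cmod (of_real l - u) \<le> r * \<mu> ^ j * \<mu>"
      using u r \<mu> by (intro mult_mono) auto
    moreover have "cmod u * cmod (of_real l - u) = cmod (P (Suc j))"
      by (simp add: P_def u_def fst_skew_map norm_mult)
    ultimately show ?case by (simp add: ac_simps)
  qed
  define d where "d = (\<Prod>j<n. 1 - 2 * P j)"
  have "((\<lambda>w. snd ((skew_map l ^^ n) (z, w))) has_field_derivative d) (at 0)"
    unfolding d_def
  proof (induction n)
    case (Suc n)
    have "((\<lambda>w. snd ((skew_map l ^^ n) (z, w)) * (1 - 2 * P n - snd ((skew_map l ^^ n) (z, w))))
        has_field_derivative (\<Prod>j<Suc n. 1 - 2 * P j)) (at 0)"
      by (rule derivative_eq_intros Suc refl)+ (simp add: snd_skew_map_funpow_axis mult.commute)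
    moreover have "snd ((skew_map l ^^ Suc n) (z, w)) =
        snd ((skew_map l ^^ n) (z, w)) * (1 - 2 * P n - snd ((skew_map l ^^ n) (z, w)))" for w
      by (simp add: snd_skew_map fst_eq)
    ultimately show ?case by simp
  qed auto
  moreover have "1 / 2 \<le> cmod d"
  proof -
    have r1: "2 * r * \<mu> ^ j \<le> 1" for j
    proof -
      have "r * \<mu> ^ j \<le> r * 1" using r \<mu> by (intro mult_left_mono) (auto simp: power_le_one)
      moreover have "2 * r \<le> 1" using l by (simp add: r_def)
      ultimately show ?thesis by simp
    qed
    have "(\<Sum>j<n. 2 * r * \<mu> ^ j) = 2 * r * (\<Sum>j<n. \<mu> ^ j)" by (simp add: sum_distrib_left)
    also have "(\<Sum>j<n. \<mu> ^ j) = (1 - \<mu> ^ n) / (1 - \<mu>)"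
      using \<mu> by (subst sum_gp_strict) auto
    also have "2 * r * ((1 - \<mu> ^ n) / (1 - \<mu>)) \<le> 2 * r * (1 / (1 - \<mu>))"
      using r \<mu> by (intro mult_left_mono divide_right_mono) auto
    finally have "1 / 2 \<le> 1 - (\<Sum>j<n. 2 * r * \<mu> ^ j)" using r\<mu> by simp
    also have "\<dots> \<le> (\<Prod>j<n. 1 - 2 * r * \<mu> ^ j)"
    proof (rule Weierstrass_prod_ineq)
      fix j
      show "2 * r * \<mu> ^ j \<in> {0..1}" using r1[of j] r \<mu> by auto
    qed
    also have "\<dots> \<le> (\<Prod>j<n. cmod (1 - 2 * P j))"
    proof (rule prod_mono, safe)
      fix j
      show "0 \<le> 1 - 2 * r * \<mu> ^ j" using r1[of j] by simp
      show "1 - 2 * r * \<mu> ^ j \<le> cmod (1 - 2 * P j)"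
        using norm_triangle_ineq2[of 1 "2 * P j"] zj[of j] by (simp add: norm_mult)
    qed
    also have "\<dots> = cmod d" by (simp add: d_def prod_norm)
    finally show ?thesis .
  qed
  ultimately show ?thesis by blast
qed

text \<open>
  On the invariant line \<open>w = 0\<close> convergence cannot be locally uniform, because by Cauchy's
  estimate the derivatives in the transversal direction would tend to 0. The lower bound on
  these derivatives needs a small first coordinate, which is reached by moving along the
  orbit, as the basin is forward invariant.
\<close>

lemma skew_basin_avoids_axis:
  assumes l: "0 < l" "l < 1" and x: "x \<in> skew_basin l"
  shows "snd x \<noteq> 0"
proof
  assume "snd x = 0"
  then have x0: "x = (fst x, 0)" by (simp add: prod_eq_iff)
  have "\<forall>\<^sub>F n in sequentially. cmod (fst ((skew_map l ^^ n) x)) < (1 - l) / 8"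
    using tendsto_norm_zero[OF skew_basin_tendsto(1)[OF x]] l by (intro order_tendstoD(2)) auto
  then obtain m where m: "cmod (fst ((skew_map l ^^ m) x)) < (1 - l) / 8"
    by (auto simp: eventually_sequentially)
  define z where "z = fst ((skew_map l ^^ m) x)"
  have "(skew_map l ^^ m) x = (z, 0)"
    unfolding z_def prod_eq_iff by (subst (2) x0) (simp add: snd_skew_map_funpow_axis)
  then have "(z, 0) \<in> skew_basin l" using skew_basin_forward[OF x, of m] by simp
  then obtain U where U: "open U" "(z, 0) \<in> U"
      "uniform_limit U (\<lambda>n. skew_map l ^^ n) (\<lambda>_. (0, 0)) sequentially"
    by (auto simp: attracting_basin_def)
  obtain A B where AB: "open A" "open B" "(z, 0) \<in> A \<times> B" "A \<times> B \<subseteq> U"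
    using open_prod_elim[OF U(1,2)] .
  have "0 \<in> B" using AB(3) by simp
  then obtain \<rho> where \<rho>: "0 < \<rho>" "cball 0 \<rho> \<subseteq> B"
    using AB(2) unfolding open_contains_cball by meson
  have "0 < \<rho> / 4" using \<rho>(1) by simp
  then obtain n where "\<forall>k\<ge>n. \<forall>x\<in>U. dist ((skew_map l ^^ k) x) (0, 0) < \<rho> / 4"
    using U(3) unfolding uniform_limit_sequentially_iff by meson
  then have n: "\<And>x. x \<in> U \<Longrightarrow> dist ((skew_map l ^^ n) x) (0, 0) < \<rho> / 4" by simp
  define f where "f w = snd ((skew_map l ^^ n) (z, w))" for w
  have hol: "f holomorphic_on S" for S
    unfolding f_def by (rule holomorphic_skew_map_funpow(2)) (auto intro: holomorphic_intros)
  obtain d where d: "(f has_field_derivative d) (at 0)" "1 / 2 \<le> cmod d"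
    using transversal_derivative_lower_bound[OF l] m unfolding f_def z_def by (meson less_imp_le)
  have "cmod ((deriv ^^ 1) f 0) \<le> fact 1 * (\<rho> / 4) / \<rho> ^ 1"
  proof (rule Cauchy_inequality)
    show "f holomorphic_on ball 0 \<rho>" "0 < \<rho>" by (fact hol \<rho>(1))+
    show "continuous_on (cball 0 \<rho>) f" by (rule holomorphic_on_imp_continuous_on[OF hol])
    fix w :: complex assume "cmod (0 - w) = \<rho>"
    then have "(z, w) \<in> U" using AB \<rho>(2) by auto
    from n[OF this] have "norm ((skew_map l ^^ n) (z, w)) < \<rho> / 4"
      by (simp add: zero_prod_def[symmetric])
    moreover have "cmod (f w) \<le> norm ((skew_map l ^^ n) (z, w))"
      unfolding f_def by (metis norm_snd_le prod.collapse)
    ultimately show "cmod (f w) \<le> \<rho> / 4" by linarith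
  qed
  then have "cmod d \<le> 1 / 4" using \<rho>(1) DERIV_imp_deriv[OF d(1)] by simp
  then show False using d(2) by simp
qed

section \<open>An attracting petal\<close>

text \<open>
  The second condition is \<open>1 / r < Re (1 / w)\<close>, free of division so that the set is visibly open.
\<close>

definition petal :: "real \<Rightarrow> (complex \<times> complex) set" where
  "petal r = {(z, w). cmod z < cmod w / 8 \<and> (cmod w)\<^sup>2 < r * Re w}"

lemma open_petal: "open (petal r)"
proof -
  have "petal r = {x. cmod (fst x) < cmod (snd x) / 8} \<inter> {x. (cmod (snd x))\<^sup>2 < r * Re (snd x)}"
    by (auto simp: petal_def)
  then show ?thesis by (auto intro!: open_Collect_less continuous_intros open_Int)
qed

lemma in_petal_iff:
  assumes "0 < r"
  shows "(z, w) \<in> petal r \<longleftrightarrow> w \<noteq> 0 \<and> cmod z < cmod w / 8 \<and> 1 / r < Re (1 / w)"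
proof (cases "w = 0")
  case False
  then have "1 / r < Re (1 / w) \<longleftrightarrow> (cmod w)\<^sup>2 < r * Re w"
    using assms by (simp add: Re_divide cmod_power2[symmetric] divide_simps mult.commute)
  with False show ?thesis by (simp add: petal_def)
qed (simp add: petal_def)

text \<open>
  In the coordinate \<open>1 / w\<close> the map is close to the translation by 1: the new value is
  \<open>1 / w + (1 + s) / (1 - t)\<close> with \<open>s = 2 z / w\<close> and \<open>t = 2 z + w\<close> both small. Since
  \<open>\<bar>l - z\<bar> \<le> \<bar>1 - t\<bar>\<close>, the first coordinate contracts at least as fast as the second, so
  \<open>z / w\<close> stays small.
\<close>

lemma petal_step:
  assumes l: "0 < l" and r: "0 < r" "r \<le> 1 / 16" "l + 4 * r \<le> 1" and x: "x \<in> petal r"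
  shows "skew_map l x \<in> petal r"
    and "Re (1 / snd x) + 1 / 4 \<le> Re (1 / snd (skew_map l x))"
proof -
  obtain z w where xzw: "x = (z, w)" by force
  define z1 w1 where "z1 = fst (skew_map l x)" and "w1 = snd (skew_map l x)"
  define t where "t = 2 * z + w"
  have w0: "w \<noteq> 0" and z: "cmod z < cmod w / 8" and Re: "1 / r < Re (1 / w)"
    using x r in_petal_iff unfolding xzw by auto
  have z1: "z1 = z * (of_real l - z)" and w1: "w1 = w * (1 - t)"
    by (simp_all add: z1_def w1_def t_def fst_skew_map snd_skew_map xzw algebra_simps)
  have "(cmod w)\<^sup>2 < r * Re w" using x by (simp add: xzw petal_def)
  also have "\<dots> \<le> r * cmod w" using r complex_Re_le_cmod by simp
  finally have wr: "cmod w < r" using w0 by (simp add: power2_eq_square)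
  have "cmod t \<le> 2 * cmod z + cmod w"
    unfolding t_def using norm_triangle_ineq[of "2 * z" w] by (simp add: norm_mult)
  then have t: "cmod t < 3 * r" using z wr r(1) by linarith
  have "cmod (of_real l - z) \<le> l + cmod z"
    using norm_triangle_ineq4[of "of_real l" z] l by simp
  moreover have den: "1 - cmod t \<le> cmod (1 - t)"
    using norm_triangle_ineq2[of 1 t] by simp
  ultimately have lt: "cmod (of_real l - z) \<le> cmod (1 - t)" using t z wr r by linarith
  have t1: "1 - t \<noteq> 0" using den t r by auto
  have w1_0: "w1 \<noteq> 0" using w0 t1 by (simp add: w1)
  have "cmod z1 \<le> cmod z * cmod (1 - t)"
    unfolding z1 norm_mult by (rule mult_left_mono[OF lt]) simp
  also have "\<dots> < cmod w / 8 * cmod (1 - t)"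
    by (rule mult_strict_right_mono[OF z]) (use t1 in simp)
  finally have z1w1: "cmod z1 < cmod w1 / 8" by (simp add: w1 norm_mult)
  define s where "s = 2 * (z / w)"
  have s: "cmod s < 1 / 4" using z w0 by (simp add: s_def norm_divide norm_mult divide_simps)
  have "1 / w1 = 1 / w + 1 + (s + t) / (1 - t)"
    using w0 t1 unfolding w1 s_def t_def by (simp add: divide_simps) (simp add: algebra_simps)
  then have "Re (1 / w1) = Re (1 / w) + 1 + Re ((s + t) / (1 - t))" by simp
  moreover have "\<bar>Re ((s + t) / (1 - t))\<bar> \<le> 3 / 4"
  proof -
    have "cmod (s + t) \<le> 3 / 4 * cmod (1 - t)"
      using norm_triangle_ineq[of s t] s t r den by linarith
    then have "cmod ((s + t) / (1 - t)) \<le> 3 / 4"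
      using t1 by (simp add: norm_divide divide_le_eq)
    then show ?thesis using abs_Re_le_cmod order_trans by blast
  qed
  ultimately have ge: "Re (1 / w) + 1 / 4 \<le> Re (1 / w1)" by linarith
  then show "Re (1 / snd x) + 1 / 4 \<le> Re (1 / snd (skew_map l x))" by (simp add: w1_def xzw)
  have "(z1, w1) \<in> petal r" using w1_0 z1w1 ge Re r(1) by (simp add: in_petal_iff)
  then show "skew_map l x \<in> petal r" by (simp add: z1_def w1_def)
qed

lemma petal_subset_skew_basin:
  assumes l: "0 < l" and r: "0 < r" "r \<le> 1 / 16" "l + 4 * r \<le> 1"
  shows "petal r \<subseteq> skew_basin l"
proof -
  have orbit: "(skew_map l ^^ n) x \<in> petal r \<and> real n / 4 \<le> Re (1 / snd ((skew_map l ^^ n) x))"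
    if x: "x \<in> petal r" for n x
  proof (induction n)
    case 0
    have "1 / r < Re (1 / snd x)" using x r(1) in_petal_iff[of r "fst x" "snd x"] by simp
    moreover have "0 < 1 / r" using r(1) by simp
    ultimately have "0 \<le> Re (1 / snd x)" by linarith
    then show ?case using x by simp
  next
    case (Suc n)
    then show ?case using petal_step[OF l r, of "(skew_map l ^^ n) x"] by (auto simp: add_divide_distrib)
  qed
  have "uniform_limit (petal r) (\<lambda>n. skew_map l ^^ n) (\<lambda>_. (0, 0)) sequentially"
    unfolding uniform_limit_sequentially_iff
  proof (intro allI impI)
    fix e :: real assume e: "0 < e"
    obtain N :: nat where N: "8 / e < real N" using reals_Archimedean2 by blast
    have "dist ((skew_map l ^^ n) x) (0, 0) < e" if n: "n \<ge> N" and x: "x \<in> petal r" for n x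
    proof -
      define z w where "z = fst ((skew_map l ^^ n) x)" and "w = snd ((skew_map l ^^ n) x)"
      have zw: "(z, w) \<in> petal r" and Re: "real n / 4 \<le> Re (1 / w)"
        using orbit[OF x, of n] by (auto simp: z_def w_def)
      have w0: "w \<noteq> 0" and z: "cmod z < cmod w / 8" using zw r(1) by (auto simp: in_petal_iff)
      have "8 / e < real n" using N n by linarith
      then have "2 / e < real n / 4" by simp
      also have "\<dots> \<le> cmod (1 / w)" using Re complex_Re_le_cmod order_trans by blast
      finally have "cmod w < e / 2" using w0 e by (simp add: norm_divide divide_simps mult.commute)
      moreover have "norm (z, w) \<le> cmod z + cmod w" by (rule norm_Pair_le)
      ultimately have "norm (z, w) < e" using z e by linarith
      then show ?thesis by (simp add: z_def w_def zero_prod_def[symmetric])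
    qed
    then show "\<exists>N. \<forall>n\<ge>N. \<forall>x\<in>petal r. dist ((skew_map l ^^ n) x) (0, 0) < e" by blast
  qed
  then show ?thesis using open_petal by (force simp: attracting_basin_def)
qed

text \<open>
  A convex piece of the basin that contains \<open>(\<epsilon>, \<epsilon>)\<close> together with its forward orbit, so that
  this orbit does not leave the component of the basin in which it starts.
\<close>

definition real_rectangle :: "real \<Rightarrow> (complex \<times> complex) set" where
  "real_rectangle e = (\<lambda>(x, y). (of_real x, of_real y)) ` ({0..e} \<times> {0<..e})"

lemma convex_real_rectangle: "convex (real_rectangle e)"
proof -
  have "linear (\<lambda>(x, y). (complex_of_real x, complex_of_real y))"
    by (rule linearI) (auto simp: scaleR_conv_of_real)
  then show ?thesis
    unfolding real_rectangle_def by (rule convex_linear_image) (intro convex_Times convex_real_interval)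
qed

text \<open>
  One step multiplies the ratio \<open>x / y\<close> of the coordinates by at most \<open>l / (1 - 3 e)\<close>, because
  \<open>l - x \<le> l\<close> and \<open>1 - 2 x - y \<ge> 1 - 3 e\<close>. For small \<open>e\<close> this factor is less than 1.
\<close>

lemma real_rectangle_orbit:
  assumes l: "0 < l" "l < 1" and e: "0 \<le> e" "e \<le> l" "3 * e < 1"
    and x: "0 \<le> x" "x \<le> e" and y: "0 < y" "y \<le> e"
  shows "\<exists>x' y'. (skew_map l ^^ n) (of_real x, of_real y) = (of_real x', of_real y') \<and>
    0 \<le> x' \<and> x' \<le> e \<and> 0 < y' \<and> y' \<le> e \<and> x' * y \<le> (l / (1 - 3 * e)) ^ n * x * y'"
proof (induction n)
  case 0
  show ?case using x y by (intro exI[of _ x] exI[of _ y]) simp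
next
  case (Suc n)
  then obtain x' y' where xy: "(skew_map l ^^ n) (of_real x, of_real y) = (of_real x', of_real y')"
    and b: "0 \<le> x'" "x' \<le> e" "0 < y'" "y' \<le> e" and le: "x' * y \<le> (l / (1 - 3 * e)) ^ n * x * y'"
    by blast
  define x2 y2 where "x2 = x' * (l - x')" and "y2 = y' * (1 - 2 * x' - y')"
  define q where "q = l / (1 - 3 * e)"
  have q: "0 < q" "l = q * (1 - 3 * e)" using l e by (auto simp: q_def)
  have "(skew_map l ^^ Suc n) (of_real x, of_real y) = (of_real x2, of_real y2)"
    by (simp add: xy prod_eq_iff fst_skew_map snd_skew_map x2_def y2_def)
  moreover have "0 \<le> x2" unfolding x2_def using b e by simp
  moreover have x2l: "x2 \<le> x' * l" unfolding x2_def using b by (intro mult_left_mono) auto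
  moreover have "x2 \<le> e"
  proof -
    have "x2 \<le> x' * 1" unfolding x2_def using b l by (intro mult_left_mono) auto
    then show ?thesis using b by simp
  qed
  moreover have y2: "y' * (1 - 3 * e) \<le> y2" unfolding y2_def using b by (intro mult_left_mono) auto
  moreover have "0 < y2" using y2 b e by (meson diff_gt_0_iff_gt less_le_trans mult_pos_pos)
  moreover have "y2 \<le> e"
  proof -
    have "y2 \<le> y' * 1" unfolding y2_def using b by (intro mult_left_mono) auto
    then show ?thesis using b by simp
  qed
  moreover have "x2 * y \<le> q ^ Suc n * x * y2"
  proof -
    have "x2 * y \<le> x' * l * y" using x2l y by (intro mult_right_mono) auto
    also have "\<dots> = l * (x' * y)" by simp
    also have "\<dots> \<le> l * (q ^ n * x * y')"
      using le l unfolding q_def by (intro mult_left_mono) auto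
    also have "\<dots> = q ^ Suc n * x * (y' * (1 - 3 * e))" unfolding q(2) by (simp add: ac_simps)
    also have "\<dots> \<le> q ^ Suc n * x * y2"
      using y2 q(1) x by (intro mult_left_mono) auto
    finally show ?thesis .
  qed
  ultimately show ?case unfolding q_def by blast
qed

lemma real_rectangle_invariant:
  assumes "0 < l" "l < 1" "0 \<le> e" "e \<le> l" "3 * e < 1" "p \<in> real_rectangle e"
  shows "(skew_map l ^^ n) p \<in> real_rectangle e"
proof -
  obtain x y where xy: "p = (of_real x, of_real y)" "0 \<le> x" "x \<le> e" "0 < y" "y \<le> e"
    using assms(6) by (auto simp: real_rectangle_def)
  from real_rectangle_orbit[OF assms(1-5) xy(2-5), of n] show ?thesis
    by (force simp: xy(1) real_rectangle_def)
qed

text \<open>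
  The ratio of the coordinates tends to 0, so every orbit in the rectangle enters the petal.
\<close>

lemma real_rectangle_subset_skew_basin:
  assumes l: "0 < l" and r: "0 < r" "r \<le> 1 / 16" "l + 4 * r \<le> 1" and e: "0 \<le> e" "e < r" "e \<le> l"
  shows "real_rectangle e \<subseteq> skew_basin l"
proof
  fix p assume "p \<in> real_rectangle e"
  then obtain x y where xy: "p = (of_real x, of_real y)" "0 \<le> x" "x \<le> e" "0 < y" "y \<le> e"
    by (auto simp: real_rectangle_def)
  have e3: "3 * e < 1" and l1: "l < 1" using e r by linarith+
  define q where "q = l / (1 - 3 * e)"
  have q: "0 < q" "q < 1" using l e e3 r by (auto simp: q_def)
  have "(\<lambda>n. q ^ n * x) \<longlonglongrightarrow> 0 * x" using q by (intro tendsto_intros LIMSEQ_power_zero) auto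
  then have "\<forall>\<^sub>F n in sequentially. q ^ n * x < y / 8" using xy by (intro order_tendstoD(2)) auto
  then obtain n where n: "q ^ n * x < y / 8" by (auto simp: eventually_sequentially)
  obtain x' y' where orb: "(skew_map l ^^ n) p = (of_real x', of_real y')"
    and b: "0 \<le> x'" "x' \<le> e" "0 < y'" "y' \<le> e" and le: "x' * y \<le> q ^ n * x * y'"
    using real_rectangle_orbit[OF l l1 e(1,3) e3 xy(2-5), of n] unfolding q_def xy(1) by blast
  note le
  also have "q ^ n * x * y' < y / 8 * y'" by (rule mult_strict_right_mono[OF n b(3)])
  finally have "x' < y' / 8" using xy(4) by (simp add: mult.commute)
  moreover have "y' * y' < r * y'" using b e by (intro mult_strict_right_mono) auto
  ultimately have "(skew_map l ^^ n) p \<in> petal r"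
    using b by (simp add: orb petal_def power2_eq_square)
  then have "(skew_map l ^^ n) p \<in> skew_basin l" using petal_subset_skew_basin[OF l r] by blast
  then show "p \<in> skew_basin l" by (rule attracting_basin_backward[OF continuous_on_skew_map])
qed

section \<open>Points far from the backward orbit\<close>

text \<open>
  The second coordinate of \<open>F\<^sup>k\<close> maps the basin into the punctured disc of radius 6.
\<close>

lemma kobayashi_dist_ge_of_orbit:
  assumes l: "0 < l" "l < 1" and U: "U \<subseteq> skew_basin l"
  shows "ereal ((ln (ln (6 / cmod (snd ((skew_map l ^^ k) p)))) -
      ln (ln (6 / cmod (snd ((skew_map l ^^ k) q))))) / 2) \<le> kobayashi_dist U p q"
proof (rule kobayashi_dist_ge_punctured_disc)
  show "(\<lambda>z. snd ((skew_map l ^^ k) (f z))) holomorphic_on ball 0 1"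
    if "f \<in> holomorphic_discs U" for f
    using that by (intro holomorphic_skew_map_funpow(2)) (auto simp: holomorphic_discs_def)
  show "snd ((skew_map l ^^ k) x) \<noteq> 0 \<and> cmod (snd ((skew_map l ^^ k) x)) < 6" if "x \<in> U" for x
    using skew_basin_avoids_axis[OF l] skew_basin_snd_bound[OF l] skew_basin_forward that U by blast
qed

lemma ln_ln_large:
  fixes R M :: real
  assumes "0 < R"
  obtains \<delta> where "0 < \<delta>" "\<And>t. 0 < t \<Longrightarrow> t < \<delta> \<Longrightarrow> M \<le> ln (ln (R / t))"
proof
  show "0 < R / exp (exp M)" using assms by simp
  fix t assume t: "0 < t" "t < R / exp (exp M)"
  then have "exp (exp M) < R / t" by (simp add: field_simps)
  then have "exp M \<le> ln (R / t)" using t(1) assms by (subst ln_ge_iff) auto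
  moreover from this have "0 < ln (R / t)" by (smt (verit) exp_gt_zero)
  ultimately show "M \<le> ln (ln (R / t))" by (simp add: ln_ge_iff)
qed

theorem theorem3p9:
  fixes l :: real
  assumes "0 < l" and "l < 1"
  shows "\<exists>\<epsilon>\<^sub>0>0. \<forall>\<epsilon>::real. 0 < \<epsilon> \<and> \<epsilon> < \<epsilon>\<^sub>0 \<longrightarrow>
    (\<forall>\<Omega>' \<in> components (attracting_basin (skew_map l) (0, 0)).
      \<forall>C>0. \<exists>p\<in>\<Omega>'.
        \<forall>q \<in> backward_orbit (skew_map l) (of_real \<epsilon>, of_real \<epsilon>) \<inter> \<Omega>'.
          kobayashi_dist \<Omega>' p q \<ge> ereal C)"
proof -
  \<comment> \<open>Small enough for the petal of size \<open>r\<close> to be invariant and for \<open>l - x\<close> to be nonnegative on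
    the rectangle.\<close>
  define r where "r = min (l / 16) ((1 - l) / 16)"
  have r0: "0 < r" using assms by (simp add: r_def)
  have "r \<le> l / 16" "r \<le> (1 - l) / 16"
    unfolding r_def by (rule min.cobounded1, rule min.cobounded2)
  then have "16 * r \<le> l" "16 * r \<le> 1 - l" by simp_all
  with assms r0 have r: "0 < r" "r \<le> 1 / 16" "l + 4 * r \<le> 1" and rl: "r \<le> l" by simp_all
  show ?thesis
  proof (intro exI[of _ r] conjI allI impI ballI r(1))
    fix \<epsilon> :: real and \<Omega>' and C :: real
    assume \<epsilon>: "0 < \<epsilon> \<and> \<epsilon> < r" and \<Omega>': "\<Omega>' \<in> components (skew_basin l)"
    let ?F = "skew_map l" and ?e = "(complex_of_real \<epsilon>, complex_of_real \<epsilon>)"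
    have sub: "\<Omega>' \<subseteq> skew_basin l" by (rule in_components_subset[OF \<Omega>'])
    show "\<exists>p\<in>\<Omega>'. \<forall>q \<in> backward_orbit ?F ?e \<inter> \<Omega>'. kobayashi_dist \<Omega>' p q \<ge> ereal C"
    proof (cases "\<exists>k. \<exists>q\<in>\<Omega>'. (?F ^^ k) q = ?e")
      case False
      moreover obtain p where "p \<in> \<Omega>'" using in_components_nonempty[OF \<Omega>'] by blast
      ultimately show ?thesis by (auto simp: backward_orbit_def)
    next
      case True
      \<comment> \<open>Only the iterates from \<open>k0\<close> on map a point of the component to the base point, so only
        those iterates of \<open>p\<close> have to be close to the axis.\<close>
      define k0 where "k0 = (LEAST k. \<exists>q\<in>\<Omega>'. (?F ^^ k) q = ?e)"
      obtain q0 where q0: "q0 \<in> \<Omega>'" "(?F ^^ k0) q0 = ?e"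
        using LeastI_ex[OF True] unfolding k0_def by blast
      have k0: "k0 \<le> k" if "q \<in> \<Omega>'" "(?F ^^ k) q = ?e" for k q
        unfolding k0_def using that by (intro Least_le) blast
      have R: "real_rectangle \<epsilon> \<subseteq> skew_basin l"
        using \<epsilon> rl by (intro real_rectangle_subset_skew_basin[OF assms(1) r]) auto
      have eR: "?e \<in> real_rectangle \<epsilon>" using \<epsilon> by (force simp: real_rectangle_def)
      define D where "D = connected_component_set (skew_basin l) ?e"
      have D: "D \<in> components (skew_basin l)" "?e \<in> D"
        unfolding D_def using R eR by (auto intro: componentsI)
      have RD: "real_rectangle \<epsilon> \<subseteq> D"
        unfolding D_def
        by (rule connected_component_maximal[OF eR convex_connected[OF convex_real_rectangle] R])
      obtain \<delta> where \<delta>: "0 < \<delta>"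
        "\<And>t. 0 < t \<Longrightarrow> t < \<delta> \<Longrightarrow> 2 * C + ln (ln (6 / \<epsilon>)) \<le> ln (ln (6 / t))"
        using ln_ln_large[of 6 "2 * C + ln (ln (6 / \<epsilon>))"] by auto
      have "\<forall>\<^sub>F n in sequentially. cmod (snd ((?F ^^ n) ?e)) < \<delta>"
        using R eR \<delta>(1) by (intro order_tendstoD(2)[OF tendsto_norm_zero[OF skew_basin_tendsto(2)]]) auto
      then obtain N where N: "\<And>n. n \<ge> N \<Longrightarrow> cmod (snd ((?F ^^ n) ?e)) < \<delta>"
        by (auto simp: eventually_sequentially)
      have "(?F ^^ N) ?e \<in> D"
        using \<epsilon> r rl RD by (intro subsetD[OF RD] real_rectangle_invariant eR assms) auto
      also have "D \<subseteq> (?F ^^ k0) ` \<Omega>'"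
      proof (rule component_subset_image)
        show "continuous_on UNIV (?F ^^ k0)" by (intro continuous_on_funpow continuous_on_skew_map)
        show "open ((?F ^^ k0) ` U)" if "open U" for U
          using open_image_skew_map that by (rule open_image_funpow)
        show "open (skew_basin l)" by (rule open_attracting_basin)
        show "bounded (skew_basin l)" by (rule bounded_skew_basin[OF assms])
        show "x \<in> skew_basin l" if "(?F ^^ k0) x \<in> skew_basin l" for x
          using that by (rule attracting_basin_backward[OF continuous_on_skew_map])
        show "\<Omega>' \<in> components (skew_basin l)" "D \<in> components (skew_basin l)" by fact+
        show "q0 \<in> \<Omega>'" "(?F ^^ k0) q0 \<in> D" using q0 D(2) by auto
      qed
      finally obtain p where p: "p \<in> \<Omega>'" "(?F ^^ k0) p = (?F ^^ N) ?e" by force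
      show ?thesis
      proof (intro bexI[OF _ p(1)] ballI)
        fix q assume "q \<in> backward_orbit ?F ?e \<inter> \<Omega>'"
        then obtain k where q: "q \<in> \<Omega>'" "(?F ^^ k) q = ?e" by (auto simp: backward_orbit_def)
        have "(?F ^^ k) p = (?F ^^ (k - k0)) ((?F ^^ k0) p)"
          using k0[OF q] by (simp add: funpow_add[symmetric] flip: o_apply[of "?F ^^ (k - k0)"])
        also have "\<dots> = (?F ^^ (k - k0 + N)) ?e" by (simp add: p(2) funpow_add)
        finally have "cmod (snd ((?F ^^ k) p)) < \<delta>" using N[of "k - k0 + N"] by simp
        moreover have "snd ((?F ^^ k) p) \<noteq> 0"
          using p(1) sub by (intro skew_basin_avoids_axis[OF assms] skew_basin_forward) auto
        ultimately have "2 * C + ln (ln (6 / \<epsilon>)) \<le> ln (ln (6 / cmod (snd ((?F ^^ k) p))))"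
          by (intro \<delta>(2)) auto
        then have "C \<le> (ln (ln (6 / cmod (snd ((?F ^^ k) p)))) -
            ln (ln (6 / cmod (snd ((?F ^^ k) q))))) / 2"
          using q(2) \<epsilon> by simp
        then show "kobayashi_dist \<Omega>' p q \<ge> ereal C"
          using kobayashi_dist_ge_of_orbit[OF assms sub, of k p q] by (meson ereal_less_eq(3) order_trans)
      qed
    qed
  qed
qed

end
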